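(* Let $T=[a,b]\subset\mathbb{R}$ be a compact interval, let $\varepsilon\in\mathbb{R}$ be a parameter, and consider on the 1-jet space $J^{1}(T,\mathbb{R}^{5})$, with coordinates $(t,x^{i},x_{1}^{i})_{i=1,\dots,5}$, the Lorenz atmospheric system $$\frac{dx^{1}}{dt}=-x^{2}x^{3}+\varepsilon x^{2}x^{5},\quad \frac{dx^{2}}{dt}=x^{1}x^{3}-\varepsilon x^{1}x^{5},\quad \frac{dx^{3}}{dt}=-x^{1}x^{2},\quad \frac{dx^{4}}{dt}=-x^{5},\quad \frac{dx^{5}}{dt}=x^{4}+\varepsilon x^{1}x^{2},$$ i.e. the system $x_1^i=X_{(1)}^{(i)}(x)$, $i=1,\dots,5$, with $X_{(1)}^{(1)}=-x^{2}x^{3}+\varepsilon x^{2}x^{5}$, $X_{(1)}^{(2)}=x^{1}x^{3}-\varepsilon x^{1}x^{5}$, $X_{(1)}^{(3)}=-x^{1}x^{2}$, $X_{(1)}^{(4)}=-x^{5}$, $X_{(1)}^{(5)}=x^{4}+\varepsilon x^{1}x^{2}$. Then the geometrical objects produced by this system and the pair of Euclidean metrics $(1,\delta_{ij})$ (as defined in the context) are the following. (i) The canonical non-linear connection has local components $\hat{\Gamma}=\left(0,\hat{N}_{(1)j}^{(i)}\right)$, where $\hat N_{(1)j}^{(i)}$ ($i$ = row, $j$ = column) are the entries of the matrix $$\hat{N}_{(1)}=\begin{pmatrix} 0 & x^{3}-\varepsilon x^{5} & 0 & 0 & 0\\ -x^{3}+\varepsilon x^{5} & 0 & -x^{1} &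 0 & \varepsilon x^{1}\\ 0 & x^{1} & 0 & 0 & 0\\ 0 & 0 & 0 & 0 & 1\\ 0 & -\varepsilon x^{1} & 0 & -1 & 0\end{pmatrix}.$$ (ii) All adapted components of the canonical generalized Cartan connection $C\hat{\Gamma}$ vanish. (iii) All adapted components of the torsion d-tensor $\hat{\mathbf{T}}$ of $C\hat\Gamma$ are zero, except $$\hat{R}_{(1)21}^{(3)}=-\hat{R}_{(1)31}^{(2)}=1,\qquad \hat{R}_{(1)21}^{(5)}=-\hat{R}_{(1)51}^{(2)}=-\varepsilon,$$ $$\hat{R}_{(1)13}^{(2)}=-\hat{R}_{(1)23}^{(1)}=-1,\qquad \hat{R}_{(1)15}^{(2)}=-\hat{R}_{(1)25}^{(1)}=\varepsilon.$$ (iv) All adapted components of the curvature d-tensor $\hat{\mathbf{R}}$ of $C\hat\Gamma$ vanish. (v) The geometric electromagnetic distinguished 2-form is $\hat{F}=\hat{F}_{(i)j}^{(1)}\,\delta x_{1}^{i}\wedge dx^{j}$ (summation over $i,j$), where $\delta x_{1}^{i}=dx_{1}^{i}+\hat{N}_{(1)k}^{(i)}dx^{k}$ for $i=1,\dots,5$, and the adapted components $\hat F_{(i)j}^{(1)}$ are the entries of the matrix $\hat{F}^{(1)}=\left(\hat{F}_{(i)j}^{(1)}\right)_{i,j=1,\dots,5}=-\hat{N}_{(1)}$. (vi) The jet geometric Yang-Mills energy is $$EYM^{\mathrm{Lorenz}}(x)=\left(\varepsilon x^{5}-x^{3}\right)^{2}+\left(x^{1}\right)^{2}+\left(\varepsilon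 x^{1}\right)^{2}+1.$$
   Context: Summation over repeated indices is used. $J^{1}(T,\mathbb{R}^{n})\to T\times\mathbb{R}^{n}$, $n\ge 2$, is the first order jet bundle with coordinates $(t,x^{i},x_{1}^{i})$, where $x_1^i$ corresponds to $dx^i/dt$. Let $X=(X_{(1)}^{(i)}(x))_{i=1,\dots,n}$ be a d-tensor field on it, i.e. under changes $\widetilde t=\widetilde t(t)$, $\widetilde x^i=\widetilde x^i(x^j)$ its components transform by $\widetilde X_{(1)}^{(i)}=\frac{\partial \widetilde x^i}{\partial x^j}\frac{dt}{d\widetilde t}X_{(1)}^{(j)}$. It gives the first order system $x_{1}^{i}=X_{(1)}^{(i)}(x(t))$ with $x_1^i=dx^i/dt$. With the Euclidean metrics $(1,\delta_{ij})$ on $T\times\mathbb{R}^n$, this system produces the jet least squares Lagrangian $$L(x,x_1)=\sum_{i=1}^{n}\left[x_{1}^{i}-X_{(1)}^{(i)}(x)\right]^{2}.$$ The geometrical objects produced by the system are those attached to $L$ through its Euler-Lagrange equations, as follows. Canonical non-linear connection: $\Gamma=(M_{(1)1}^{(i)},N_{(1)j}^{(i)})$, where $M_{(1)1}^{(i)}=0$ (the time metric being the constant 1) and $N_{(1)j}^{(i)}=\partial G^{i}/\partial x_1^j$, the Euler-Lagrange equations of $L$ being written as $\ddot x^i+2G^i(x,\dot x)=0$. Equivalently, $$N_{(1)j}^{(i)}=-\frac12\left[\frac{\partial X_{(1)}^{(i)}}{\partial x^{j}}-\frac{\partial X_{(1)}^{(j)}}{\partial x^{i}}\right].$$ Adapted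 frame: $\frac{\delta}{\delta t}=\frac{\partial}{\partial t}-M_{(1)1}^{(i)}\frac{\partial}{\partial x_1^i}$, $\frac{\delta}{\delta x^j}=\frac{\partial}{\partial x^j}-N_{(1)j}^{(i)}\frac{\partial}{\partial x_1^i}$, $\frac{\partial}{\partial x_1^i}$; dual coframe: $dt$, $dx^i$, $\delta x_1^i=dx_1^i+M_{(1)1}^{(i)}dt+N_{(1)k}^{(i)}dx^k$. Canonical generalized Cartan connection: the linear connection with adapted components $(\kappa_{11}^1,G_{j1}^{k},L_{jk}^{i},C_{j(k)}^{i(1)})$, where, with $g_{ij}=\frac12\frac{\partial^2 L}{\partial x_1^i\partial x_1^j}$, $\kappa_{11}^1$ is the Christoffel symbol of the time metric $1$, and $$G_{j1}^{k}=\tfrac12 g^{km}\frac{\delta g_{mj}}{\delta t},\qquad L_{jk}^{i}=\tfrac12 g^{im}\left(\frac{\delta g_{jm}}{\delta x^k}+\frac{\delta g_{km}}{\delta x^j}-\frac{\delta g_{jk}}{\delta x^m}\right),\qquad C_{j(k)}^{i(1)}=\tfrac12 g^{im}\left(\frac{\partial g_{jm}}{\partial x_1^k}+\frac{\partial g_{km}}{\partial x_1^j}-\frac{\partial g_{jk}}{\partial x_1^m}\right).$$ On the frame, $\frac{\delta}{\delta t}$ is differentiated using $\kappa_{11}^1$ in the $t$ direction (and is parallel in the other directions), and the fields $\frac{\delta}{\delta x^j}$ and $\frac{\partial}{\partial x_1^j}$ are differentiated using $G,L,C$ in the $t$, $x$, $x_1$ directions respectively (with the additional term $-\delta^i_j\kappa_{11}^1$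 in the $t$ direction for $\frac{\partial}{\partial x_1^j}$). Torsion d-tensor: in the convention used here, its only possibly non-zero adapted components are $$R_{(1)jk}^{(i)}=-\frac12\left[\frac{\partial^{2}X_{(1)}^{(i)}}{\partial x^{k}\partial x^{j}}-\frac{\partial^{2}X_{(1)}^{(j)}}{\partial x^{k}\partial x^{i}}\right]=\frac{\partial N_{(1)j}^{(i)}}{\partial x^k},$$ and all its other adapted components are zero; this formula is taken as the definition of these components. Curvature d-tensor: the curvature tensor of the linear connection above, $\mathbf{R}(U,V)W=\nabla_U\nabla_VW-\nabla_V\nabla_UW-\nabla_{[U,V]}W$, expressed in the adapted frame. Electromagnetic distinguished 2-form: $F=F_{(i)j}^{(1)}\delta x_1^i\wedge dx^j$, with $F_{(i)j}^{(1)}=\frac12\left[\frac{\partial X_{(1)}^{(i)}}{\partial x^{j}}-\frac{\partial X_{(1)}^{(j)}}{\partial x^{i}}\right]$. Jet geometric Yang-Mills energy: $EYM(x)=\sum_{i=1}^{n-1}\sum_{j=i+1}^{n}\left[F_{(i)j}^{(1)}\right]^{2}$. In the claim, $n=5$ and hats denote these objects for the Lorenz system. *)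

theory Defs
  imports "HOL-Analysis.Analysis"
begin

text \<open>Coordinates \<open>(t, x, x\<^sub>1)\<close> on the 1-jet space, written \<open>(t, x, y)\<close> below. The same type is used
  for points and, in the natural frame, for tangent vectors.\<close>

type_synonym 'n jet = "real \<times> (real^'n) \<times> (real^'n)"

definition jets :: "real set \<Rightarrow> ('n::finite) jet set" where
  "jets T = T \<times> UNIV \<times> UNIV"

definition pd :: "'n::finite \<Rightarrow> (real^'n \<Rightarrow> real) \<Rightarrow> real^'n \<Rightarrow> real" where
  "pd j f x = frechet_derivative f (at x) (axis j 1)"

text \<open>One-sided at the end points of the time interval \<open>T\<close>.\<close>

definition jet_deriv ::
    "real set \<Rightarrow> (('n::finite) jet \<Rightarrow> 'b::real_normed_vector) \<Rightarrow> 'n jet \<Rightarrow> 'n jet \<Rightarrow> 'b" where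
  "jet_deriv T f p v = frechet_derivative f (at p within jets T) v"


subsection \<open>Least squares Lagrangian and its Euler--Lagrange equations\<close>

definition ls_lagrangian :: "(real^'n \<Rightarrow> real^'n) \<Rightarrow> real^('n::finite) \<Rightarrow> real^'n \<Rightarrow> real" where
  "ls_lagrangian X x y = (\<Sum>i\<in>UNIV. (y $ i - X x $ i)\<^sup>2)"

text \<open>The equations \<open>d/dt (\<partial>L/\<partial>y\<^sup>i) = \<partial>L/\<partial>x\<^sup>i\<close> at time \<open>t\<close> along the curve \<open>c\<close> with velocity \<open>c'\<close>.\<close>

definition euler_lagrange_at ::
    "real set \<Rightarrow> (real^'n \<Rightarrow> real^'n \<Rightarrow> real) \<Rightarrow> (real \<Rightarrow> real^('n::finite)) \<Rightarrow> (real \<Rightarrow> real^'n)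
      \<Rightarrow> real \<Rightarrow> bool" where
  "euler_lagrange_at T L c c' t \<longleftrightarrow>
    (\<forall>i. ((\<lambda>s. pd i (L (c s)) (c' s)) has_real_derivative pd i (\<lambda>x. L x (c' t)) (c t))
           (at t within T))"

text \<open>\<open>is_spray T L G\<close>: for \<open>C\<^sup>2\<close> curves the Euler--Lagrange equations of \<open>L\<close> read
  \<open>c'' + 2 G(c, c') = 0\<close>. The equivalence is required at each single time, so that it determines
  \<open>G\<close> at every \<open>(x, y)\<close>: the initial data and the second derivative of \<open>c\<close> at a given time are
  arbitrary.\<close>

definition is_spray ::
    "real set \<Rightarrow> (real^'n \<Rightarrow> real^'n \<Rightarrow> real) \<Rightarrow> (real^('n::finite) \<Rightarrow> real^'n \<Rightarrow> real^'n) \<Rightarrow> bool" where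
  "is_spray T L G \<longleftrightarrow>
    (\<forall>c c' c''.
       (\<forall>t\<in>T. (c has_vector_derivative c' t) (at t within T) \<and>
              (c' has_vector_derivative c'' t) (at t within T)) \<and> continuous_on T c'' \<longrightarrow>
       (\<forall>t\<in>T. euler_lagrange_at T L c c' t \<longleftrightarrow> c'' t + 2 *\<^sub>R G (c t) (c' t) = 0))"

definition spray ::
    "real set \<Rightarrow> (real^'n \<Rightarrow> real^'n \<Rightarrow> real) \<Rightarrow> real^('n::finite) \<Rightarrow> real^'n \<Rightarrow> real^'n" where
  "spray T L = (THE G. is_spray T L G)"


subsection \<open>Canonical non-linear connection and adapted frame\<close>

definition time_metric :: "real \<Rightarrow> real" where
  "time_metric t = 1"

definition kappa :: "real set \<Rightarrow> real \<Rightarrow> real" where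
  "kappa T t = 1 / (2 * time_metric t) * vector_derivative time_metric (at t within T)"

text \<open>The temporal components \<open>M = - \<kappa> y\<close> for a general time metric; here \<open>\<kappa>\<close> is that of the
  constant metric, which makes them zero.\<close>

definition nlc_M :: "real set \<Rightarrow> ('n::finite) jet \<Rightarrow> real^'n" where
  "nlc_M T = (\<lambda>(t, x, y). - kappa T t *\<^sub>R y)"

text \<open>Row \<open>i\<close>, column \<open>j\<close>: \<open>\<partial>G\<^sup>i/\<partial>y\<^sup>j\<close>.\<close>

definition nlc_N ::
    "real set \<Rightarrow> (real^'n \<Rightarrow> real^'n \<Rightarrow> real) \<Rightarrow> ('n::finite) jet \<Rightarrow> real^'n^'n" where
  "nlc_N T L = (\<lambda>(t, x, y). \<chi> i j. pd j (\<lambda>z. spray T L x z $ i) y)"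

text \<open>Labels of the adapted frame \<open>\<delta>/\<delta>t\<close>, \<open>\<delta>/\<delta>x\<^sup>j\<close>, \<open>\<partial>/\<partial>y\<^sup>j\<close> and of its dual coframe
  \<open>dt\<close>, \<open>dx\<^sup>j\<close>, \<open>\<delta>y\<^sup>j\<close>.\<close>

datatype 'n idx = Tm | Hor 'n | Ver 'n

instance idx :: (finite) finite
proof
  have "(UNIV :: 'a idx set) = insert Tm (range Hor \<union> range Ver)"
  proof (rule UNIV_eq_I)
    show "A \<in> insert Tm (range Hor \<union> range Ver)" for A :: "'a idx"
      by (cases A) simp_all
  qed
  moreover have "finite (insert Tm (range Hor \<union> range Ver) :: 'a idx set)"
    by simp
  ultimately show "finite (UNIV :: 'a idx set)"
    by (rule ssubst)
qed

fun frame :: "real set \<Rightarrow> (real^'n \<Rightarrow> real^'n \<Rightarrow> real) \<Rightarrow> 'n idx \<Rightarrow> ('n::finite) jet \<Rightarrow> 'n jet" where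
  "frame T L Tm p = (1, 0, - nlc_M T p)"
| "frame T L (Hor j) p = (0, axis j 1, - column j (nlc_N T L p))"
| "frame T L (Ver j) p = (0, 0, axis j 1)"

fun coframe ::
    "real set \<Rightarrow> (real^'n \<Rightarrow> real^'n \<Rightarrow> real) \<Rightarrow> 'n idx \<Rightarrow> ('n::finite) jet \<Rightarrow> 'n jet \<Rightarrow> real" where
  "coframe T L Tm p (v\<^sub>t, v\<^sub>x, v\<^sub>y) = v\<^sub>t"
| "coframe T L (Hor i) p (v\<^sub>t, v\<^sub>x, v\<^sub>y) = v\<^sub>x $ i"
| "coframe T L (Ver i) p (v\<^sub>t, v\<^sub>x, v\<^sub>y) =
     v\<^sub>y $ i + nlc_M T p $ i * v\<^sub>t + (\<Sum>k\<in>UNIV. nlc_N T L p $ i $ k * v\<^sub>x $ k)"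

definition frame_deriv ::
    "real set \<Rightarrow> (real^'n \<Rightarrow> real^'n \<Rightarrow> real) \<Rightarrow> 'n idx \<Rightarrow> (('n::finite) jet \<Rightarrow> real) \<Rightarrow> 'n jet \<Rightarrow> real"
  where "frame_deriv T L A f p = jet_deriv T f p (frame T L A p)"


subsection \<open>Canonical generalized Cartan connection\<close>

definition fund_metric ::
    "(real^'n \<Rightarrow> real^'n \<Rightarrow> real) \<Rightarrow> ('n::finite) jet \<Rightarrow> real^'n^'n" where
  "fund_metric L = (\<lambda>(t, x, y). \<chi> i j. 1/2 * pd i (pd j (L x)) y)"

definition cartan_G ::
    "real set \<Rightarrow> (real^'n \<Rightarrow> real^'n \<Rightarrow> real) \<Rightarrow> 'n \<Rightarrow> 'n \<Rightarrow> ('n::finite) jet \<Rightarrow> real" where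
  "cartan_G T L k j p = 1/2 * (\<Sum>m\<in>UNIV. matrix_inv (fund_metric L p) $ k $ m *
     frame_deriv T L Tm (\<lambda>q. fund_metric L q $ m $ j) p)"

text \<open>\<open>cartan_L T L i j k\<close> is \<open>L\<^sup>i\<^sub>j\<^sub>k\<close> and \<open>cartan_C T L i j k\<close> is \<open>C\<^sup>i\<^sub>j\<^sub>(\<^sub>k\<^sub>)\<close>; the last index is the
  direction of differentiation.\<close>

definition cartan_L ::
    "real set \<Rightarrow> (real^'n \<Rightarrow> real^'n \<Rightarrow> real) \<Rightarrow> 'n \<Rightarrow> 'n \<Rightarrow> 'n \<Rightarrow> ('n::finite) jet \<Rightarrow> real" where
  "cartan_L T L i j k p = 1/2 * (\<Sum>m\<in>UNIV. matrix_inv (fund_metric L p) $ i $ m *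
     (frame_deriv T L (Hor k) (\<lambda>q. fund_metric L q $ j $ m) p
      + frame_deriv T L (Hor j) (\<lambda>q. fund_metric L q $ k $ m) p
      - frame_deriv T L (Hor m) (\<lambda>q. fund_metric L q $ j $ k) p))"

definition cartan_C ::
    "real set \<Rightarrow> (real^'n \<Rightarrow> real^'n \<Rightarrow> real) \<Rightarrow> 'n \<Rightarrow> 'n \<Rightarrow> 'n \<Rightarrow> ('n::finite) jet \<Rightarrow> real" where
  "cartan_C T L i j k p = 1/2 * (\<Sum>m\<in>UNIV. matrix_inv (fund_metric L p) $ i $ m *
     (frame_deriv T L (Ver k) (\<lambda>q. fund_metric L q $ j $ m) p
      + frame_deriv T L (Ver j) (\<lambda>q. fund_metric L q $ k $ m) p
      - frame_deriv T L (Ver m) (\<lambda>q. fund_metric L q $ j $ k) p))"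

text \<open>\<open>conn T L C B A\<close> is the coefficient of \<open>E\<^sub>C\<close> in \<open>\<nabla>\<^bsub>E\<^sub>B\<^esub> E\<^sub>A\<close>, for the adapted frame \<open>E\<close>.\<close>

fun conn ::
    "real set \<Rightarrow> (real^'n \<Rightarrow> real^'n \<Rightarrow> real) \<Rightarrow> 'n idx \<Rightarrow> 'n idx \<Rightarrow> 'n idx \<Rightarrow> ('n::finite) jet \<Rightarrow> real"
  where
  "conn T L Tm Tm Tm p = kappa T (fst p)"
| "conn T L (Hor i) Tm (Hor j) p = cartan_G T L i j p"
| "conn T L (Hor i) (Hor k) (Hor j) p = cartan_L T L i j k p"
| "conn T L (Hor i) (Ver k) (Hor j) p = cartan_C T L i j k p"
| "conn T L (Ver i) Tm (Ver j) p =
     cartan_G T L i j p - (if i = j then kappa T (fst p) else 0)"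
| "conn T L (Ver i) (Hor k) (Ver j) p = cartan_L T L i j k p"
| "conn T L (Ver i) (Ver k) (Ver j) p = cartan_C T L i j k p"
| "conn T L _ _ _ p = 0"

definition nabla ::
    "real set \<Rightarrow> (real^'n \<Rightarrow> real^'n \<Rightarrow> real) \<Rightarrow>
      ('n jet \<Rightarrow> 'n jet) \<Rightarrow> ('n jet \<Rightarrow> 'n jet) \<Rightarrow> ('n::finite) jet \<Rightarrow> 'n jet" where
  "nabla T L U W p = (\<Sum>C\<in>UNIV.
     (jet_deriv T (\<lambda>q. coframe T L C q (W q)) p (U p)
      + (\<Sum>B\<in>UNIV. \<Sum>A\<in>UNIV.
           conn T L C B A p * coframe T L B p (U p) * coframe T L A p (W p)))
     *\<^sub>R frame T L C p)"

definition lie_bracket ::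
    "real set \<Rightarrow> ('n jet \<Rightarrow> 'n jet) \<Rightarrow> ('n jet \<Rightarrow> 'n jet) \<Rightarrow> ('n::finite) jet \<Rightarrow> 'n jet" where
  "lie_bracket T U V p = jet_deriv T V p (U p) - jet_deriv T U p (V p)"

definition curvature ::
    "real set \<Rightarrow> (real^'n \<Rightarrow> real^'n \<Rightarrow> real) \<Rightarrow> ('n jet \<Rightarrow> 'n jet) \<Rightarrow> ('n jet \<Rightarrow> 'n jet)
      \<Rightarrow> ('n jet \<Rightarrow> 'n jet) \<Rightarrow> ('n::finite) jet \<Rightarrow> 'n jet" where
  "curvature T L U V W p =
     nabla T L U (nabla T L V W) p - nabla T L V (nabla T L U W) p
     - nabla T L (lie_bracket T U V) W p"

definition curvature_comp ::
    "real set \<Rightarrow> (real^'n \<Rightarrow> real^'n \<Rightarrow> real) \<Rightarrow> 'n idx \<Rightarrow> 'n idx \<Rightarrow> 'n idx \<Rightarrow> 'n idx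
      \<Rightarrow> ('n::finite) jet \<Rightarrow> real" where
  "curvature_comp T L D C A B p =
     coframe T L D p (curvature T L (frame T L A) (frame T L B) (frame T L C) p)"


subsection \<open>Torsion\<close>

text \<open>The adapted components of the torsion d-tensor, upper index first, in the convention in which
  \<open>R\<^sup>i\<^sub>j\<^sub>k = \<partial>N\<^sup>i\<^sub>j/\<partial>x\<^sup>k\<close>. They are prescribed by this formula, which is not skew in \<open>j, k\<close>, and are not
  computed as \<open>\<nabla>\<^sub>U V - \<nabla>\<^sub>V U - [U, V]\<close>.\<close>

fun torsion_comp ::
    "(real^'n \<Rightarrow> real^'n) \<Rightarrow> 'n idx \<Rightarrow> 'n idx \<Rightarrow> 'n idx \<Rightarrow> ('n::finite) jet \<Rightarrow> real" where
  "torsion_comp X (Ver i) (Hor j) (Hor k) (t, x, y) =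
     - (1/2) * (pd k (pd j (\<lambda>z. X z $ i)) x - pd k (pd i (\<lambda>z. X z $ j)) x)"
| "torsion_comp X _ _ _ p = 0"


subsection \<open>Electromagnetic form and Yang--Mills energy\<close>

definition em_F :: "(real^'n \<Rightarrow> real^'n) \<Rightarrow> real^('n::finite) \<Rightarrow> real^'n^'n" where
  "em_F X x = (\<chi> i j. 1/2 * (pd j (\<lambda>z. X z $ i) x - pd i (\<lambda>z. X z $ j) x))"

definition wedge :: "('v \<Rightarrow> real) \<Rightarrow> ('v \<Rightarrow> real) \<Rightarrow> 'v \<Rightarrow> 'v \<Rightarrow> real" where
  "wedge \<alpha> \<beta> u v = \<alpha> u * \<beta> v - \<alpha> v * \<beta> u"

definition em_form ::
    "real set \<Rightarrow> (real^'n \<Rightarrow> real^'n) \<Rightarrow> ('n::finite) jet \<Rightarrow> 'n jet \<Rightarrow> 'n jet \<Rightarrow> real" where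
  "em_form T X p u v = (\<Sum>i\<in>UNIV. \<Sum>j\<in>UNIV. em_F X (fst (snd p)) $ i $ j *
     wedge (coframe T (ls_lagrangian X) (Ver i) p) (coframe T (ls_lagrangian X) (Hor j) p) u v)"

text \<open>For a numeral index type such as \<open>5\<close>, \<open>of_nat\<close> maps \<open>{1..n}\<close> bijectively onto the type, with
  \<open>n\<close> going to the element \<open>n = 0\<close>. Summing over naturals keeps the usual order \<open>1 < \<dots> < n\<close>, which
  is not that of the type.\<close>

definition yang_mills_energy ::
    "(real^'n::{finite,comm_ring_1} \<Rightarrow> real^'n::{finite,comm_ring_1}) \<Rightarrow>
      real^'n::{finite,comm_ring_1} \<Rightarrow> real" where
  "yang_mills_energy X x =
     (\<Sum>i=1..CARD('n) - 1. \<Sum>j=i+1..CARD('n). (em_F X x $ of_nat i $ of_nat j)\<^sup>2)"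


subsection \<open>The Lorenz atmospheric system\<close>

definition lorenz :: "real \<Rightarrow> real^5 \<Rightarrow> real^5" where
  "lorenz \<epsilon> x = vector
     [- x$2 * x$3 + \<epsilon> * x$2 * x$5,
      x$1 * x$3 - \<epsilon> * x$1 * x$5,
      - x$1 * x$2,
      - x$5,
      x$4 + \<epsilon> * x$1 * x$2]"

definition lorenz_N :: "real \<Rightarrow> real^5 \<Rightarrow> real^5^5" where
  "lorenz_N \<epsilon> x = vector
     [vector [0, x$3 - \<epsilon> * x$5, 0, 0, 0],
      vector [- x$3 + \<epsilon> * x$5, 0, - x$1, 0, \<epsilon> * x$1],
      vector [0, x$1, 0, 0, 0],
      vector [0, 0, 0, 0, 1],
      vector [0, - \<epsilon> * x$1, 0, - 1, 0]]"

end

theory Submission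
  imports Defs
begin

text \<open>
  The Euler--Lagrange equations of \<open>L = \<bar>y - X(x)\<bar>\<^sup>2\<close> are \<open>c'' + 2 G(c, c') = 0\<close> with \<open>G\<close> affine in the
  velocity, and prescribing \<open>c\<close>, \<open>c'\<close>, \<open>c''\<close> at one time determines \<open>G\<close>; hence \<open>N = \<partial>G/\<partial>y\<close> is
  minus the skew part of the Jacobian of \<open>X\<close>. The fundamental metric is the identity, so all
  connection coefficients vanish, the adapted frame is parallel for any \<open>N\<close>, and the connection is
  flat. What remains are the first and second derivatives of the Lorenz field.
\<close>

subsection \<open>Partial derivatives\<close>

lemma pd_eqI: "(f has_derivative f') (at x) \<Longrightarrow> pd j f x = f' (axis j 1)"
  by (metis pd_def frechet_derivative_at)

text \<open>Expanding the direction in the standard basis turns the total derivative into partial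
  ones, the form in which the chain rule is used along curves.\<close>

lemma has_derivative_pd:
  assumes "f differentiable at x"
  shows "(f has_derivative (\<lambda>h. \<Sum>j\<in>UNIV. pd j f x * h $ j)) (at x)"
proof -
  let ?D = "frechet_derivative f (at x)"
  have D: "(f has_derivative ?D) (at x)"
    using assms by (simp add: frechet_derivative_works)
  then interpret bounded_linear ?D
    by (rule has_derivative_bounded_linear)
  have "?D h = (\<Sum>j\<in>UNIV. pd j f x * h $ j)" for h
  proof -
    have "?D h = ?D (\<Sum>j\<in>UNIV. h $ j *\<^sub>R axis j 1)"
      by (metis (no_types) basis_expansion scalar_mult_eq_scaleR)
    then show ?thesis
      by (simp add: sum scaleR pd_def mult.commute)
  qed
  then have "?D = (\<lambda>h. \<Sum>j\<in>UNIV. pd j f x * h $ j)" ..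
  with D show ?thesis
    by simp
qed

lemma differentiable_vec_nth [simp]: "(\<lambda>x. x $ i) differentiable F"
  by (intro bounded_linear_imp_differentiable bounded_linear_vec_nth)

lemma pd_const [simp]: "pd k (\<lambda>_. c) x = 0"
  by (simp add: pd_def)

lemma pd_nth [simp]: "pd k (\<lambda>x. x $ i) x = (if i = k then 1 else 0)"
  by (subst pd_eqI[OF bounded_linear_imp_has_derivative[OF bounded_linear_vec_nth]])
     (auto simp: axis_def)

context
  fixes f g :: "real^'n \<Rightarrow> real" and x :: "real^'n"
  assumes f: "f differentiable at x" and g: "g differentiable at x"
begin

lemma pd_add: "pd k (\<lambda>x. f x + g x) x = pd k f x + pd k g x"
  using f g unfolding frechet_derivative_works
  by (subst pd_eqI[OF has_derivative_add]) (auto simp: pd_def)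

lemma pd_diff: "pd k (\<lambda>x. f x - g x) x = pd k f x - pd k g x"
  using f g unfolding frechet_derivative_works
  by (subst pd_eqI[OF has_derivative_diff]) (auto simp: pd_def)

lemma pd_mult: "pd k (\<lambda>x. f x * g x) x = f x * pd k g x + pd k f x * g x"
  using f g unfolding frechet_derivative_works
  by (subst pd_eqI[OF has_derivative_mult]) (auto simp: pd_def)

end

lemma pd_uminus:
  assumes "f differentiable at x"
  shows "pd k (\<lambda>x. - f x) x = - pd k f x"
  using assms unfolding frechet_derivative_works
  by (subst pd_eqI[OF has_derivative_minus]) (auto simp: pd_def)

lemmas pd_arith = pd_add pd_diff pd_mult pd_uminus


subsection \<open>The spray of a least squares Lagrangian\<close>

lemma pd_ls_lagrangian_velocity: "pd i (ls_lagrangian X x) y = 2 * (y $ i - X x $ i)"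
proof -
  have "((\<lambda>y. ls_lagrangian X x y) has_derivative (\<lambda>h. \<Sum>k\<in>UNIV. 2 * (y $ k - X x $ k) * h $ k)) (at y)"
    unfolding ls_lagrangian_def
    by (auto intro!: derivative_eq_intros bounded_linear_imp_has_derivative[OF bounded_linear_vec_nth] simp: algebra_simps)
  from pd_eqI[OF this] show ?thesis
    by (simp add: axis_def if_distrib cong: if_cong)
qed

lemma pd_ls_lagrangian_position:
  assumes "\<And>k. (\<lambda>z. X z $ k) differentiable at x"
  shows "pd i (\<lambda>x. ls_lagrangian X x y) x =
    - 2 * (\<Sum>k\<in>UNIV. (y $ k - X x $ k) * pd i (\<lambda>z. X z $ k) x)"
proof -
  have "((\<lambda>x. ls_lagrangian X x y) has_derivative
      (\<lambda>h. \<Sum>k\<in>UNIV. - 2 * (y $ k - X x $ k) * frechet_derivative (\<lambda>z. X z $ k) (at x) h)) (at x)"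
    unfolding ls_lagrangian_def using assms unfolding frechet_derivative_works
    by (auto intro!: derivative_eq_intros simp: algebra_simps)
  from pd_eqI[OF this] show ?thesis
    unfolding pd_def[of i "\<lambda>z. X z $ _"] by (simp add: sum_distrib_left algebra_simps)
qed

text \<open>Half of the Euler-Lagrange equation solved for \<open>c''\<close>: the part linear in
  \<open>y\<close> carries twice the skew part of the Jacobian of \<open>X\<close>, and the last sum
  is the gradient of half the squared norm of \<open>X\<close>.\<close>

definition ls_spray :: "(real^'n \<Rightarrow> real^'n) \<Rightarrow> real^('n::finite) \<Rightarrow> real^'n \<Rightarrow> real^'n" where
  "ls_spray X x y = (\<chi> i. - (1/2) *
     ((\<Sum>j\<in>UNIV. (pd j (\<lambda>z. X z $ i) x - pd i (\<lambda>z. X z $ j) x) * y $ j)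
      + (\<Sum>k\<in>UNIV. X x $ k * pd i (\<lambda>z. X z $ k) x)))"

lemma is_spray_ls_spray:
  assumes "a < b" and diff: "\<And>k x. (\<lambda>z. X z $ k) differentiable at x"
  shows "is_spray {a..b} (ls_lagrangian X) (ls_spray X)"
  unfolding is_spray_def
proof (intro allI impI ballI)
  fix c c' c'' :: "real \<Rightarrow> real^'a" and t
  assume C: "(\<forall>t\<in>{a..b}. (c has_vector_derivative c' t) (at t within {a..b}) \<and>
      (c' has_vector_derivative c'' t) (at t within {a..b})) \<and> continuous_on {a..b} c''"
    and t: "t \<in> {a..b}"
  then have c: "(c has_derivative (\<lambda>h. h *\<^sub>R c' t)) (at t within {a..b})"
    and c': "(c' has_derivative (\<lambda>h. h *\<^sub>R c'' t)) (at t within {a..b})"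
    by (auto simp: has_vector_derivative_def)
  \<comment> \<open>Since \<open>a < b\<close>, every time, end points included, is a limit point of
    the interval, so derivatives within it are unique.\<close>
  have neq_bot: "at t within {a..b} \<noteq> bot"
    using \<open>a < b\<close> t islimpt_Icc trivial_limit_within by blast
  let ?dX = "\<lambda>j i. pd j (\<lambda>z. X z $ i) (c t)"
  define D where "D i = 2 * (c'' t $ i - (\<Sum>j\<in>UNIV. ?dX j i * c' t $ j))" for i
  have D: "((\<lambda>s. 2 * (c' s $ i - X (c s) $ i)) has_real_derivative D i) (at t within {a..b})" for i
  proof -
    have "((\<lambda>s. X (c s) $ i) has_derivative (\<lambda>h. \<Sum>j\<in>UNIV. ?dX j i * (h *\<^sub>R c' t) $ j)) (at t within {a..b})"
      by (rule has_derivative_compose[OF c has_derivative_pd[OF diff]])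
    then have "((\<lambda>s. 2 * (c' s $ i - X (c s) $ i)) has_derivative
        (\<lambda>h. 2 * ((h *\<^sub>R c'' t) $ i - (\<Sum>j\<in>UNIV. ?dX j i * (h *\<^sub>R c' t) $ j)))) (at t within {a..b})"
      by (intro has_derivative_mult_right has_derivative_diff
          bounded_linear.has_derivative[OF bounded_linear_vec_nth c'])
    then show ?thesis
      by (rule has_derivative_imp_has_field_derivative)
         (simp add: D_def algebra_simps sum_distrib_left)
  qed
  have "(((\<lambda>s. 2 * (c' s $ i - X (c s) $ i)) has_real_derivative
          - 2 * (\<Sum>k\<in>UNIV. (c' t $ k - X (c t) $ k) * ?dX i k)) (at t within {a..b})) \<longleftrightarrow>
        (c'' t + 2 *\<^sub>R ls_spray X (c t) (c' t)) $ i = 0" for i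
  proof -
    \<comment> \<open>Uniqueness turns the differential statement into an equation between numbers:
      the momentum has derivative \<open>D i\<close> by the chain rule, so \<open>E\<close> must be
      \<open>D i\<close>.\<close>
    have "(((\<lambda>s. 2 * (c' s $ i - X (c s) $ i)) has_real_derivative E) (at t within {a..b}))
        \<longleftrightarrow> D i = E" for E
      using D[of i] vector_derivative_unique_within[OF neq_bot]
      unfolding has_real_derivative_iff_has_vector_derivative by blast
    moreover have "D i = - 2 * (\<Sum>k\<in>UNIV. (c' t $ k - X (c t) $ k) * ?dX i k) \<longleftrightarrow>
        (c'' t + 2 *\<^sub>R ls_spray X (c t) (c' t)) $ i = 0"
      by (auto simp: D_def ls_spray_def algebra_simps sum.distrib sum_subtractf)
    ultimately show ?thesis
      by simp
  qed
  then show "euler_lagrange_at {a..b} (ls_lagrangian X) c c' t \<longleftrightarrow>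
      c'' t + 2 *\<^sub>R ls_spray X (c t) (c' t) = 0"
    unfolding euler_lagrange_at_def vec_eq_iff pd_ls_lagrangian_velocity
      pd_ls_lagrangian_position[OF diff] by simp
qed

text \<open>Makes the \<open>THE\<close> in \<open>spray\<close> well defined. A curve of constant
  acceleration suffices, because \<open>is_spray\<close> compares the two equations at a single
  time.\<close>

lemma is_spray_unique:
  assumes "a \<le> b" and G: "is_spray {a..b} L G" and H: "is_spray {a..b} L H"
  shows "G = H"
proof (intro ext)
  fix x y
  \<comment> \<open>The curve through \<open>x\<close> with velocity \<open>y\<close> at time \<open>a\<close> that satisfies the equation of \<open>G\<close> there.\<close>
  define w where "w = - 2 *\<^sub>R G x y"
  define c where "c s = x + (s - a) *\<^sub>R y + ((s - a)\<^sup>2 / 2) *\<^sub>R w" for s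
  define c' where "c' s = y + (s - a) *\<^sub>R w" for s
  have "(c has_vector_derivative c' t) (at t within {a..b})" for t
    unfolding c_def c'_def has_vector_derivative_def
    by (auto intro!: derivative_eq_intros simp: algebra_simps diff_divide_distrib)
  moreover have "(c' has_vector_derivative w) (at t within {a..b})" for t
    unfolding c'_def has_vector_derivative_def
    by (auto intro!: derivative_eq_intros simp: algebra_simps)
  ultimately have C: "(\<forall>t\<in>{a..b}. (c has_vector_derivative c' t) (at t within {a..b}) \<and>
      (c' has_vector_derivative w) (at t within {a..b})) \<and> continuous_on {a..b} (\<lambda>_. w)"
    by simp
  have "c a = x" "c' a = y" "a \<in> {a..b}"
    using \<open>a \<le> b\<close> by (simp_all add: c_def c'_def)
  then have "w + 2 *\<^sub>R G x y = 0 \<longleftrightarrow> w + 2 *\<^sub>R H x y = 0"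
    using G[unfolded is_spray_def, rule_format, OF C, of a]
      H[unfolded is_spray_def, rule_format, OF C, of a] by simp
  then show "G x y = H x y"
    by (simp add: w_def)
qed

lemma spray_ls_lagrangian:
  assumes "a < b" "\<And>k x. (\<lambda>z. X z $ k) differentiable at x"
  shows "spray {a..b} (ls_lagrangian X) = ls_spray X"
  unfolding spray_def
  using assms is_spray_ls_spray is_spray_unique[OF less_imp_le]
  by (intro the_equality) blast+

text \<open>The spray is affine in the velocity, so its derivative is the coefficient matrix of the
  linear part.\<close>

lemma nlc_N_ls_lagrangian:
  assumes "a < b" "\<And>k x. (\<lambda>z. X z $ k) differentiable at x"
  shows "nlc_N {a..b} (ls_lagrangian X) (t, x, y) = - em_F X x"
proof -
  have "pd j (\<lambda>z. ls_spray X x z $ i) y =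
      - (1/2) * (pd j (\<lambda>z. X z $ i) x - pd i (\<lambda>z. X z $ j) x)" for i j
  proof -
    have "((\<lambda>z. ls_spray X x z $ i) has_derivative (\<lambda>h. - (1/2) *
        (\<Sum>j\<in>UNIV. (pd j (\<lambda>z. X z $ i) x - pd i (\<lambda>z. X z $ j) x) * h $ j))) (at y)"
      unfolding ls_spray_def
      by (auto intro!: derivative_eq_intros
          bounded_linear_imp_has_derivative[OF bounded_linear_vec_nth] simp: algebra_simps)
    from pd_eqI[OF this] show ?thesis
      by (simp add: axis_def if_distrib cong: if_cong)
  qed
  then show ?thesis
    by (simp add: nlc_N_def em_F_def spray_ls_lagrangian[OF assms] vec_eq_iff)
qed


subsection \<open>The Cartan connection of a least squares Lagrangian\<close>

text \<open>\<open>jets {a..b}\<close> has boundary points over \<open>a\<close> and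
  \<open>b\<close>, so uniqueness is taken from a nondegenerate closed box inside it that contains
  \<open>p\<close>.\<close>

lemma has_derivative_jets_unique:
  fixes f :: "('n::finite) jet \<Rightarrow> 'b::real_normed_vector"
  assumes "a < b" and p: "p \<in> jets {a..b}"
    and "(f has_derivative f') (at p within jets {a..b})"
    and "(f has_derivative f'') (at p within jets {a..b})"
  shows "f' = f''"
proof -
  obtain t x y where [simp]: "p = (t, x, y)"
    by (cases p)
  \<comment> \<open>The box covers the whole time interval; in \<open>x - 1\<close> the
    \<open>1\<close> is the all-ones vector.\<close>
  let ?l = "(a, x - 1, y - 1)" and ?u = "(b, x + 1, y + 1)"
  have sub: "cbox ?l ?u \<subseteq> jets {a..b}"
    by (auto simp: jets_def cbox_Pair_eq)
  show ?thesis
  proof (rule frechet_derivative_unique_within_closed_interval)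
    show "?l \<bullet> i < ?u \<bullet> i" if "i \<in> Basis" for i
      using that \<open>a < b\<close> by (auto simp: Basis_prod_def Basis_vec_def inner_axis)
    show "p \<in> cbox ?l ?u"
      using p by (auto simp: jets_def cbox_Pair_eq mem_box_cart)
  qed (use assms sub has_derivative_subset in blast)+
qed

text \<open>\<open>frechet_derivative\<close> is a choice among derivatives; uniqueness forces it to
  be the zero map.\<close>

lemma jet_deriv_const_on:
  assumes "a < b" "p \<in> jets {a..b}" "\<And>q. q \<in> jets {a..b} \<Longrightarrow> f q = c"
  shows "jet_deriv {a..b} f p v = 0"
proof -
  have "(f has_derivative (\<lambda>_. 0)) (at p within jets {a..b})"
    using has_derivative_transform[OF assms(2) assms(3) has_derivative_const] .
  then have "frechet_derivative f (at p within jets {a..b}) = (\<lambda>_. 0)"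
    by (metis has_derivative_jets_unique[OF assms(1,2)] differentiableI frechet_derivative_works)
  then show ?thesis
    by (simp add: jet_deriv_def)
qed

lemma kappa_eq_0: "a < b \<Longrightarrow> t \<in> {a..b} \<Longrightarrow> kappa {a..b} t = 0"
  unfolding kappa_def time_metric_def
  by (subst vector_derivative_within_closed_interval[where f' = 0]) auto

lemma nlc_M_eq_0: "a < b \<Longrightarrow> t \<in> {a..b} \<Longrightarrow> nlc_M {a..b} (t, x, y) = 0"
  by (simp add: nlc_M_def kappa_eq_0)

lemma fund_metric_ls_lagrangian: "fund_metric (ls_lagrangian X) p = mat 1"
proof -
  have "pd i (\<lambda>y. 2 * (y $ j - X x $ j)) y = (if i = j then 2 else 0)" for i j x y
    by (simp add: pd_arith)
  then show ?thesis
    by (simp add: fund_metric_def pd_ls_lagrangian_velocity[abs_def] mat_def vec_eq_iff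
        split: prod.split)
qed

lemma frame_deriv_const:
  assumes "a < b" "p \<in> jets {a..b}"
  shows "frame_deriv {a..b} L A (\<lambda>_. c) p = 0"
  unfolding frame_deriv_def by (rule jet_deriv_const_on[OF assms refl])

lemma cartan_eq_0:
  assumes "a < b" "p \<in> jets {a..b}"
  shows "cartan_G {a..b} (ls_lagrangian X) k j p = 0"
    and "cartan_L {a..b} (ls_lagrangian X) i j k p = 0"
    and "cartan_C {a..b} (ls_lagrangian X) i j k p = 0"
  by (simp_all add: cartan_G_def cartan_L_def cartan_C_def fund_metric_ls_lagrangian
      frame_deriv_const[OF assms])

lemma conn_eq_0:
  assumes "a < b" "p \<in> jets {a..b}"
  shows "conn {a..b} (ls_lagrangian X) C B A p = 0"
proof -
  have "kappa {a..b} (fst p) = 0"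
    using assms by (auto simp: jets_def kappa_eq_0)
  then show ?thesis
    by (cases "({a..b}, ls_lagrangian X, C, B, A, p)" rule: conn.cases)
       (auto simp: cartan_eq_0[OF assms])
qed

text \<open>\<open>nlc_M\<close> and \<open>nlc_N\<close> enter the frame with a minus sign and the
  coframe with a plus sign, and cancel.\<close>

lemma coframe_frame: "coframe T L C p (frame T L A p) = (if C = A then 1 else 0)"
  by (cases C; cases A)
     (auto simp: axis_def column_def if_distrib cong: if_cong)

lemma coframe_0: "coframe T L C p 0 = 0"
  by (cases C) (simp_all add: zero_prod_def)

text \<open>By duality a frame field has constant adapted components, so \<open>N\<close> is never
  differentiated.\<close>

lemma nabla_frame:
  assumes "a < b" "p \<in> jets {a..b}"
  shows "nabla {a..b} (ls_lagrangian X) U (frame {a..b} (ls_lagrangian X) A) p = 0"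
  unfolding nabla_def coframe_frame conn_eq_0[OF assms]
  by (simp add: jet_deriv_const_on[OF assms refl])

text \<open>Serves the iterated derivatives in the curvature: the inner one is known to vanish only
  on \<open>jets {a..b}\<close>.\<close>

lemma nabla_vanishing_field:
  assumes "a < b" "p \<in> jets {a..b}" "\<And>q. q \<in> jets {a..b} \<Longrightarrow> W q = 0"
  shows "nabla {a..b} (ls_lagrangian X) U W p = 0"
proof -
  have "jet_deriv {a..b} (\<lambda>q. coframe {a..b} (ls_lagrangian X) C q (W q)) p v = 0" for C v
    by (rule jet_deriv_const_on[OF assms(1,2)]) (simp add: assms(3) coframe_0)
  then show ?thesis
    by (simp add: nabla_def conn_eq_0[OF assms(1,2)])
qed

text \<open>\<open>nabla_frame\<close> holds in every direction, so the bracket need not be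
  computed.\<close>

lemma curvature_comp_eq_0:
  assumes "a < b" "p \<in> jets {a..b}"
  shows "curvature_comp {a..b} (ls_lagrangian X) D C A B p = 0"
  unfolding curvature_comp_def curvature_def
  by (simp add: nabla_vanishing_field[OF assms] nabla_frame[OF \<open>a < b\<close>] assms(2) coframe_0)


subsection \<open>The Lorenz system\<close>

lemma exhaust_5:
  fixes x :: 5
  shows "x = 1 \<or> x = 2 \<or> x = 3 \<or> x = 4 \<or> x = 5"
proof (induct x)
  case (of_int z)
  \<comment> \<open>In the type \<open>5\<close> the numerals \<open>0\<close> and \<open>5\<close>
    denote the same element.\<close>
  then have "z = 0 \<or> z = 1 \<or> z = 2 \<or> z = 3 \<or> z = 4" by fastforce
  then show ?case by auto
qed

lemma forall_5: "(\<forall>i::5. P i) \<longleftrightarrow> P 1 \<and> P 2 \<and> P 3 \<and> P 4 \<and> P 5"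
  by (metis exhaust_5)

lemma vector_5 [simp]:
  "(vector [u, v, w, x, y] :: ('a::zero)^5) $ 1 = u"
  "(vector [u, v, w, x, y] :: ('a::zero)^5) $ 2 = v"
  "(vector [u, v, w, x, y] :: ('a::zero)^5) $ 3 = w"
  "(vector [u, v, w, x, y] :: ('a::zero)^5) $ 4 = x"
  "(vector [u, v, w, x, y] :: ('a::zero)^5) $ 5 = y"
  unfolding vector_def by simp_all

lemma lorenz_differentiable: "(\<lambda>z. lorenz \<epsilon> z $ k) differentiable at x"
proof -
  have "\<forall>k. (\<lambda>z. lorenz \<epsilon> z $ k) differentiable at x"
    by (simp add: forall_5 lorenz_def)
  then show ?thesis ..
qed

definition lorenz_jacobian :: "real \<Rightarrow> real^5 \<Rightarrow> real^5^5" where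
  "lorenz_jacobian \<epsilon> x = vector
     [vector [0, - x$3 + \<epsilon> * x$5, - x$2, 0, \<epsilon> * x$2],
      vector [x$3 - \<epsilon> * x$5, 0, x$1, 0, - \<epsilon> * x$1],
      vector [- x$2, - x$1, 0, 0, 0],
      vector [0, 0, 0, 0, - 1],
      vector [\<epsilon> * x$2, \<epsilon> * x$1, 0, 1, 0]]"

lemma pd_lorenz: "pd j (\<lambda>z. lorenz \<epsilon> z $ i) x = lorenz_jacobian \<epsilon> x $ i $ j"
proof -
  have "\<forall>i j. pd j (\<lambda>z. lorenz \<epsilon> z $ i) x = lorenz_jacobian \<epsilon> x $ i $ j"
    by (simp add: forall_5 lorenz_def lorenz_jacobian_def pd_arith)
  then show ?thesis by blast
qed

lemma em_F_lorenz: "em_F (lorenz \<epsilon>) x = - lorenz_N \<epsilon> x"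
  by (simp add: em_F_def pd_lorenz vec_eq_iff forall_5 lorenz_jacobian_def lorenz_N_def)

lemma nlc_N_lorenz:
  "a < b \<Longrightarrow> nlc_N {a..b} (ls_lagrangian (lorenz \<epsilon>)) (t, x, y) = lorenz_N \<epsilon> x"
  by (simp add: nlc_N_ls_lagrangian lorenz_differentiable em_F_lorenz)

text \<open>The values are the coefficients of \<open>x$1\<close>, \<open>x$3\<close>,
  \<open>x$5\<close> in \<open>lorenz_N\<close>; skewness in \<open>i, j\<close> pairs the
  triples.\<close>

lemma torsion_lorenz:
  "torsion_comp (lorenz \<epsilon>) (Ver i) (Hor j) (Hor k) (t, x, y) =
     (if (i, j, k) \<in> {(3, 2, 1), (1, 2, 3)} then 1
      else if (i, j, k) \<in> {(2, 3, 1), (2, 1, 3)} then - 1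
      else if (i, j, k) \<in> {(2, 5, 1), (2, 1, 5)} then \<epsilon>
      else if (i, j, k) \<in> {(5, 2, 1), (1, 2, 5)} then - \<epsilon>
      else 0)"
    (is "?P i j k")
proof -
  have "\<forall>i j k. ?P i j k"
    \<comment> \<open>With \<open>abs_def\<close> the inner derivative is rewritten as a function of
      the point, ready for the outer \<open>pd\<close>.\<close>
    by (simp add: forall_5 pd_lorenz[abs_def] lorenz_jacobian_def pd_arith)
  then show ?thesis by blast
qed

text \<open>Above the diagonal only the entries (1,2), (2,3), (2,5), (4,5) of
  \<open>lorenz_N\<close> can be nonzero; they give the four summands in this order.\<close>

lemma yang_mills_energy_lorenz:
  "yang_mills_energy (lorenz \<epsilon>) x = (\<epsilon> * x$5 - x$3)\<^sup>2 + (x$1)\<^sup>2 + (\<epsilon> * x$1)\<^sup>2 + 1"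
proof -
  have "yang_mills_energy (lorenz \<epsilon>) x =
     (\<Sum>i\<in>{1, 2, 3, 4}. \<Sum>j=i+1..5. (em_F (lorenz \<epsilon>) x $ of_nat i $ of_nat j)\<^sup>2)"
    by (simp add: yang_mills_energy_def atLeastAtMost_insertL numeral_eq_Suc atLeastAtMostSuc_conv)
  then show ?thesis
    by (simp add: em_F_lorenz lorenz_N_def numeral_eq_Suc atLeastAtMostSuc_conv algebra_simps)
qed

theorem corollary2p2:
  fixes a b \<epsilon> :: real and T :: "real set" and L :: "real^5 \<Rightarrow> real^5 \<Rightarrow> real"
  assumes "a < b"
    and T_def: "T = {a..b}"
    and L_def: "L = ls_lagrangian (lorenz \<epsilon>)"
  shows
    "(\<forall>t\<in>T. \<forall>x y. nlc_M T (t, x, y) = 0 \<and> nlc_N T L (t, x, y) = lorenz_N \<epsilon> x)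
     \<and>
     (\<forall>t\<in>T. \<forall>x y. kappa T t = 0 \<and>
        (\<forall>k j. cartan_G T L k j (t, x, y) = 0) \<and>
        (\<forall>i j k. cartan_L T L i j k (t, x, y) = 0) \<and>
        (\<forall>i j k. cartan_C T L i j k (t, x, y) = 0))
     \<and>
     (\<forall>t\<in>T. \<forall>x y.
        torsion_comp (lorenz \<epsilon>) (Ver 3) (Hor 2) (Hor 1) (t, x, y) = 1 \<and>
        torsion_comp (lorenz \<epsilon>) (Ver 2) (Hor 3) (Hor 1) (t, x, y) = - 1 \<and>
        torsion_comp (lorenz \<epsilon>) (Ver 5) (Hor 2) (Hor 1) (t, x, y) = - \<epsilon> \<and>
        torsion_comp (lorenz \<epsilon>) (Ver 2) (Hor 5) (Hor 1) (t, x, y) = \<epsilon> \<and>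
        torsion_comp (lorenz \<epsilon>) (Ver 2) (Hor 1) (Hor 3) (t, x, y) = - 1 \<and>
        torsion_comp (lorenz \<epsilon>) (Ver 1) (Hor 2) (Hor 3) (t, x, y) = 1 \<and>
        torsion_comp (lorenz \<epsilon>) (Ver 2) (Hor 1) (Hor 5) (t, x, y) = \<epsilon> \<and>
        torsion_comp (lorenz \<epsilon>) (Ver 1) (Hor 2) (Hor 5) (t, x, y) = - \<epsilon> \<and>
        (\<forall>C A B. (C, A, B) \<notin>
            {(Ver 3, Hor 2, Hor 1), (Ver 2, Hor 3, Hor 1),
             (Ver 5, Hor 2, Hor 1), (Ver 2, Hor 5, Hor 1),
             (Ver 2, Hor 1, Hor 3), (Ver 1, Hor 2, Hor 3),
             (Ver 2, Hor 1, Hor 5), (Ver 1, Hor 2, Hor 5)} \<longrightarrow>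
           torsion_comp (lorenz \<epsilon>) C A B (t, x, y) = 0))
     \<and>
     (\<forall>t\<in>T. \<forall>x y. \<forall>D C A B. curvature_comp T L D C A B (t, x, y) = 0)
     \<and>
     (\<forall>t\<in>T. \<forall>x y.
        em_F (lorenz \<epsilon>) x = - lorenz_N \<epsilon> x \<and>
        (\<forall>i v\<^sub>t v\<^sub>x v\<^sub>y. coframe T L (Ver i) (t, x, y) (v\<^sub>t, v\<^sub>x, v\<^sub>y) =
           v\<^sub>y $ i + (\<Sum>k\<in>UNIV. lorenz_N \<epsilon> x $ i $ k * v\<^sub>x $ k)) \<and>
        em_form T (lorenz \<epsilon>) (t, x, y) =
          (\<lambda>u v. \<Sum>i\<in>UNIV. \<Sum>j\<in>UNIV. (- lorenz_N \<epsilon> x) $ i $ j *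
             wedge (\<lambda>(v\<^sub>t, v\<^sub>x, v\<^sub>y). v\<^sub>y $ i + (\<Sum>k\<in>UNIV. lorenz_N \<epsilon> x $ i $ k * v\<^sub>x $ k))
                   (\<lambda>(v\<^sub>t, v\<^sub>x, v\<^sub>y). v\<^sub>x $ j) u v))
     \<and>
     (\<forall>x. yang_mills_energy (lorenz \<epsilon>) x =
        (\<epsilon> * x$5 - x$3)\<^sup>2 + (x$1)\<^sup>2 + (\<epsilon> * x$1)\<^sup>2 + 1)"


proof -
  have jets: "(t, x, y) \<in> jets {a..b}" if "t \<in> {a..b}" for t and x y :: "real^5"
    using that by (simp add: jets_def)
  note nlc = nlc_M_eq_0[OF \<open>a < b\<close>] nlc_N_lorenz[OF \<open>a < b\<close>]
  \<comment> \<open>Labels other than \<open>Ver\<close>, \<open>Hor\<close>, \<open>Hor\<close>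
    fall under the zero clause; the rest are read off the table.\<close>
  have torsion: "torsion_comp (lorenz \<epsilon>) C A B (t, x, y) = 0"
    if "(C, A, B) \<notin>
            {(Ver 3, Hor 2, Hor 1), (Ver 2, Hor 3, Hor 1),
             (Ver 5, Hor 2, Hor 1), (Ver 2, Hor 5, Hor 1),
             (Ver 2, Hor 1, Hor 3), (Ver 1, Hor 2, Hor 3),
             (Ver 2, Hor 1, Hor 5), (Ver 1, Hor 2, Hor 5)}" for C A B t x y
    using that
    by (cases C; cases A; cases B) (auto simp: torsion_lorenz simp del: torsion_comp.simps(1))
  \<comment> \<open>Stated as equations of functions, since \<open>wedge\<close> takes the covectors
    unapplied.\<close>
  have coframe: "coframe T L (Ver i) (t, x, y) =
      (\<lambda>(v\<^sub>t, v\<^sub>x, v\<^sub>y). v\<^sub>y $ i + (\<Sum>k\<in>UNIV. lorenz_N \<epsilon> x $ i $ k * v\<^sub>x $ k))"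
    "coframe T L (Hor i) (t, x, y) = (\<lambda>(v\<^sub>t, v\<^sub>x, v\<^sub>y). v\<^sub>x $ i)"
    if "t \<in> {a..b}" for t x y i
    using that by (auto simp: fun_eq_iff T_def L_def nlc)
  show ?thesis
    unfolding em_form_def em_F_lorenz yang_mills_energy_lorenz
    using coframe torsion
    by (simp add: T_def L_def nlc kappa_eq_0[OF \<open>a < b\<close>] cartan_eq_0[OF \<open>a < b\<close> jets]
        curvature_comp_eq_0[OF \<open>a < b\<close> jets] torsion_lorenz del: torsion_comp.simps(1) coframe.simps)
qed

end
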